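(* For every integer $P$ with $2\le P\le 8$, the fully non-centered (right-hand side) $P$-point Lagrange interpolatory subdivision scheme $S_P$ is uniformly convergent.
   Context: $l^\infty(\mathbb{Z})$ is the space of bounded real sequences indexed by $\mathbb{Z}$. The scheme $S_P$ is the linear interpolatory scheme defined by $S_P(f)_{2n}=f_n$ and $S_P(f)_{2n+1}=q_n\left(n+\tfrac12\right)$, where $q_n$ is the unique polynomial of degree at most $P-1$ with $q_n(n+i)=f_{n+i}$ for $i=0,1,\dots,P-1$ (so the stencil is $\{n,n+1,\dots,n+P-1\}$). A subdivision scheme $T$ is uniformly convergent if for every $f\in l^\infty(\mathbb{Z})$ there is a continuous function $f^\infty:\mathbb{R}\to\mathbb{R}$ with $\lim_{j\to+\infty}\sup_{n\in\mathbb{Z}}|T^j(f)_n-f^\infty(2^{-j}n)|=0$, where $T^j$ is the $j$-fold iterate. *)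

theory Defs
  imports "HOL-Analysis.Analysis" "HOL-Computational_Algebra.Polynomial"
begin

definition linf :: "(int \<Rightarrow> real) set" where
  "linf = {f. bounded (range f)}"

definition interpolates :: "nat \<Rightarrow> (int \<Rightarrow> real) \<Rightarrow> int \<Rightarrow> real poly \<Rightarrow> bool" where
  "interpolates P f n q \<longleftrightarrow>
     degree q \<le> P - 1 \<and> (\<forall>i<P. poly q (of_int (n + int i)) = f (n + int i))"

definition stencil_poly :: "nat \<Rightarrow> (int \<Rightarrow> real) \<Rightarrow> int \<Rightarrow> real poly" where
  "stencil_poly P f n = (THE q. interpolates P f n q)"

text \<open>The description operator above is meaningful for every \<open>P \<ge> 1\<close>.\<close>

lemma interpolates_ex1:
  assumes "P \<ge> 1"
  shows "\<exists>!q. interpolates P f n q"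
proof (rule ex_ex1I)
  show "\<exists>q. interpolates P f n q"
    using assms
  proof (induction P rule: dec_induct)
    case base
    show ?case
      by (rule exI[of _ "[:f n:]"]) (simp add: interpolates_def)
  next
    case (step m)
    then obtain q where q: "degree q \<le> m - 1"
      "\<And>i. i < m \<Longrightarrow> poly q (of_int (n + int i)) = f (n + int i)"
      by (auto simp: interpolates_def)
    define w :: "real poly" where "w = (\<Prod>i<m. [:- of_int (n + int i), 1:])"
    have w0: "poly w (of_int (n + int i)) = 0" if "i < m" for i
      using that by (auto simp: w_def poly_prod)
    have wm: "poly w (of_int (n + int m)) \<noteq> 0"
      by (simp add: w_def poly_prod)
    have "degree w \<le> (\<Sum>i<m. 1)"
      unfolding w_def by (rule order.trans[OF degree_prod_sum_le]) (auto simp: o_def)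
    then have dw: "degree w \<le> m" by simp
    define c where "c = (f (n + int m) - poly q (of_int (n + int m))) / poly w (of_int (n + int m))"
    have "interpolates (Suc m) f n (q + smult c w)"
      unfolding interpolates_def
    proof (intro conjI allI impI)
      have "degree (smult c w) \<le> m"
        using dw by (meson degree_smult_le order.trans)
      then show "degree (q + smult c w) \<le> Suc m - 1"
        using q(1) by (intro degree_add_le) auto
      fix i assume "i < Suc m"
      then consider "i < m" | "i = m" by linarith
      then show "poly (q + smult c w) (of_int (n + int i)) = f (n + int i)"
      proof cases
        case 1
        then show ?thesis using q(2)[OF 1] w0[OF 1] by simp
      next
        case 2
        then show ?thesis using wm by (simp add: c_def del: of_int_add)
      qed
    qed
    then show ?case ..
  qed
next
  fix q r assume qr: "interpolates P f n q" "interpolates P f n r"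
  show "q = r"
  proof (rule ccontr)
    assume "q \<noteq> r"
    then have nz: "q - r \<noteq> 0" by simp
    let ?A = "(\<lambda>i. of_int (n + int i) :: real) ` {..<P}"
    have "card ?A = P"
      by (subst card_image) (auto simp: inj_on_def)
    moreover have "?A \<subseteq> {x. poly (q - r) x = 0}"
      using qr by (auto simp: interpolates_def simp del: of_int_add)
    ultimately have "P \<le> card {x. poly (q - r) x = 0}"
      using card_mono[OF poly_roots_finite[OF nz]] by metis
    also have "\<dots> \<le> degree (q - r)"
      by (rule card_poly_roots_bound[OF nz])
    also have "\<dots> \<le> P - 1"
      using qr by (intro degree_diff_le) (auto simp: interpolates_def)
    finally show False using assms by simp
  qed
qed

text \<open>On \<^typ>\<open>int\<close>, \<open>div\<close> rounds down, so an odd \<open>k\<close> equals \<open>2 * (k div 2) + 1\<close>.\<close>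

definition right_scheme :: "nat \<Rightarrow> (int \<Rightarrow> real) \<Rightarrow> int \<Rightarrow> real" where
  "right_scheme P f k =
     (if even k then f (k div 2)
      else poly (stencil_poly P f (k div 2)) (of_int (k div 2) + 1 / 2))"

lemma right_scheme_even: "right_scheme P f (2 * n) = f n"
  by (simp add: right_scheme_def)

lemma right_scheme_odd:
  "right_scheme P f (2 * n + 1) = poly (stencil_poly P f n) (of_int n + 1 / 2)"
  by (simp add: right_scheme_def)

text \<open>The supremum is taken in the extended reals, since a \<^typ>\<open>real\<close> supremum of an unbounded
  set would be an arbitrary value.\<close>

definition uniformly_convergent_scheme :: "((int \<Rightarrow> real) \<Rightarrow> int \<Rightarrow> real) \<Rightarrow> bool" where
  "uniformly_convergent_scheme T \<longleftrightarrow>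
     (\<forall>f\<in>linf. \<exists>g :: real \<Rightarrow> real. continuous_on UNIV g \<and>
        (\<lambda>j. SUP n. ereal \<bar>(T ^^ j) f n - g (of_int n / 2 ^ j)\<bar>) \<longlonglongrightarrow> 0)"

end

theory Submission
  imports Defs "HOL-Computational_Algebra.Polynomial_FPS"
begin

text \<open>By Newton's forward formula, the scheme is \<open>f\<^sub>2\<^sub>n = f\<^sub>n\<close> and \<open>f\<^sub>2\<^sub>n\<^sub>+\<^sub>1 = (\<Sum>k<P. (1/2 gchoose k) \<Delta>\<^sup>k f\<^sub>n)\<close>, a pair
  of polynomials in the difference operator \<open>\<Delta>\<close> (lemma \<open>right_scheme_eq_subdiv\<close>). The second polynomial
  is \<open>sqrt (1 + X)\<close> modulo \<open>X ^ P\<close>, and this congruence is inherited, with its order lowered by one, by the scheme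
  of the differences. Hence for every \<open>k \<le> P\<close> there is a scheme \<open>S\<^sub>k\<close> with \<open>\<Delta>\<^sup>k T = S\<^sub>k \<Delta>\<^sup>k\<close>, and for \<open>k < P\<close> it is
  multiplication by \<open>2\<^sup>-\<^sup>k\<close> up to differences of the next order (lemma \<open>derived_lagrange\<close>).

  The analytic input is that \<open>S\<^sub>P\<close>, applied twice, contracts the supremum norm; for \<open>2 \<le> P \<le> 8\<close> this is a finite
  computation with at most four coefficients on each parity class. Then the \<open>P\<close>-th differences of the
  iterates decay geometrically, and so do, by descending induction on \<open>k \<ge> 1\<close>, all differences of lower order
  (lemma \<open>uniformly_convergent_if_contractive\<close>). Geometric decay of the first differences of an interpolatory
  scheme gives uniform convergence (lemma \<open>uniformly_convergent_if_decays\<close>).\<close>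

section \<open>Subdivision by polynomials in the difference operator\<close>

text \<open>The forward difference operator \<open>\<Delta>\<close>.\<close>

definition diff :: "(int \<Rightarrow> real) \<Rightarrow> int \<Rightarrow> real" where
  "diff f n = f (n + 1) - f n"

text \<open>The operator \<open>p(\<Delta>)\<close> applied to \<open>f\<close>, for a real polynomial \<open>p\<close>.\<close>

definition dpoly :: "real poly \<Rightarrow> (int \<Rightarrow> real) \<Rightarrow> int \<Rightarrow> real" where
  "dpoly p f n = (\<Sum>i\<le>degree p. coeff p i * (diff ^^ i) f n)"

lemma dpoly_eq:
  assumes "degree p \<le> m"
  shows "dpoly p f n = (\<Sum>i\<le>m. coeff p i * (diff ^^ i) f n)"
  unfolding dpoly_def using assms
  by (intro sum.mono_neutral_left) (auto simp: coeff_eq_0)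

lemma dpoly_0 [simp]: "dpoly 0 f n = 0"
  by (simp add: dpoly_def)

lemma dpoly_pCons [simp]: "dpoly (pCons a p) f n = a * f n + dpoly p (diff f) n"
proof -
  have "dpoly (pCons a p) f n = (\<Sum>i\<le>Suc (degree p). coeff (pCons a p) i * (diff ^^ i) f n)"
    by (intro dpoly_eq degree_pCons_le)
  also have "\<dots> = a * f n + dpoly p (diff f) n"
    by (simp add: sum.atMost_Suc_shift dpoly_def funpow_swap1 del: sum.atMost_Suc funpow.simps(2))
       (simp add: funpow_Suc_right del: funpow.simps(2))
  finally show ?thesis .
qed

lemma dpoly_add: "dpoly (p + q) f n = dpoly p f n + dpoly q f n"
proof -
  let ?m = "max (degree p) (degree q)"
  have "degree (p + q) \<le> ?m" by (rule degree_add_le_max)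
  then show ?thesis
    by (simp add: dpoly_eq[of _ ?m] sum.distrib ring_distribs)
qed

lemma dpoly_uminus: "dpoly (- p) f n = - dpoly p f n"
  by (simp add: dpoly_def sum_negf)

lemma dpoly_minus: "dpoly (p - q) f n = dpoly p f n - dpoly q f n"
  using dpoly_add[of p "- q"] by (simp add: dpoly_uminus)

lemma dpoly_diff: "dpoly p (diff f) n = dpoly p f (n + 1) - dpoly p f n"
proof (induction p arbitrary: f)
  case (pCons a p)
  have "dpoly (pCons a p) (diff f) n = a * diff f n + dpoly p (diff (diff f)) n"
    by simp
  also have "\<dots> = a * (f (n + 1) - f n) + (dpoly p (diff f) (n + 1) - dpoly p (diff f) n)"
    unfolding pCons.IH by (simp only: diff_def)
  finally show ?case by (simp add: algebra_simps)
qed simp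

text \<open>The subdivision operator given by a pair \<open>(A, B)\<close> of polynomials: the new value at \<open>2n\<close> is
  \<open>A(\<Delta>)f (n)\<close> and the one at \<open>2n + 1\<close> is \<open>B(\<Delta>)f (n)\<close>. Every linear shift-invariant scheme whose finite stencil at \<open>n\<close> is contained in
  \<open>{n, n + 1, \<dots>}\<close> has this form.\<close>

definition subdiv :: "real poly \<times> real poly \<Rightarrow> (int \<Rightarrow> real) \<Rightarrow> int \<Rightarrow> real" where
  "subdiv S f k = dpoly (if even k then fst S else snd S) f (k div 2)"

text \<open>The scheme of the differences, with polynomials \<open>(B - A) / X\<close> and \<open>((1 + X) A - B) / X\<close>; here
  \<open>poly_shift 1\<close> divides by \<open>X\<close> and drops the remainder, which is \<open>0\<close> exactly when \<open>A\<close> and \<open>B\<close> have the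
  same constant coefficient.\<close>

definition derived :: "real poly \<times> real poly \<Rightarrow> real poly \<times> real poly" where
  "derived S = (poly_shift 1 (snd S - fst S), poly_shift 1 (fst S + pCons 0 (fst S) - snd S))"

lemma poly_shift_pCons [simp]: "poly_shift (Suc 0) (pCons a p) = p"
  by (simp add: poly_eq_iff coeff_poly_shift)

lemma dpoly_shift: "coeff p 0 = 0 \<Longrightarrow> dpoly (poly_shift (Suc 0) p) (diff f) n = dpoly p f n"
  by (cases p) simp

lemma diff_subdiv:
  assumes "coeff (fst S) 0 = coeff (snd S) 0"
  shows "diff (subdiv S f) = subdiv (derived S) (diff f)"
proof
  fix k
  show "diff (subdiv S f) k = subdiv (derived S) (diff f) k"
  proof (cases "even k")
    case True
    then have "(k + 1) div 2 = k div 2" by simp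
    with True show ?thesis using assms
      by (simp add: subdiv_def derived_def diff_def[of "subdiv S f"] dpoly_shift dpoly_minus)
  next
    case False
    then have "(k + 1) div 2 = k div 2 + 1" by (auto elim!: oddE)
    moreover have "dpoly (snd (derived S)) (diff f) n = dpoly (fst S) f (n + 1) - dpoly (snd S) f n"
      for n
      using assms by (simp add: derived_def dpoly_shift dpoly_minus dpoly_add)
        (simp add: dpoly_diff)
    ultimately show ?thesis using False
      by (simp add: subdiv_def diff_def[of "subdiv S f"])
  qed
qed

section \<open>The right-hand side Lagrange scheme in Newton form\<close>

text \<open>The Lagrange scheme as a pair of polynomials: by Newton's forward formula, the
  interpolating polynomial at \<open>n + 1/2\<close> takes the value \<open>\<Sum>k<P. (1/2 gchoose k) \<Delta>\<^sup>k f (n)\<close>.\<close>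

definition lagrange :: "nat \<Rightarrow> real poly \<times> real poly" where
  "lagrange P = (1, Poly (map (\<lambda>k. 1 / 2 gchoose k) [0..<P]))"

lemma dpoly_lagrange: "dpoly (snd (lagrange P)) f n = (\<Sum>k<P. (1 / 2 gchoose k) * (diff ^^ k) f n)"
proof -
  let ?p = "Poly (map (\<lambda>k. (1 / 2 :: real) gchoose k) [0..<P])"
  have c: "coeff ?p k = (if k < P then 1 / 2 gchoose k else 0)" for k
    by (simp add: nth_default_def)
  have "degree ?p \<le> P" by (rule degree_le) (simp add: c del: coeff_Poly_eq)
  then have "dpoly ?p f n = (\<Sum>i\<le>P. coeff ?p i * (diff ^^ i) f n)" by (rule dpoly_eq)
  also have "\<dots> = (\<Sum>k<P. (1 / 2 gchoose k) * (diff ^^ k) f n)"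
    by (simp add: c del: coeff_Poly_eq flip: lessThan_Suc_atMost)
  finally show ?thesis by (simp add: lagrange_def)
qed

lemma newton_forward: "f (n + int i) = (\<Sum>k\<le>i. of_nat (i choose k) * (diff ^^ k) f n)"
proof (induction i arbitrary: f)
  case 0 then show ?case by simp
next
  case (Suc i)
  have "f (n + int (Suc i)) = f (n + int i) + diff f (n + int i)"
    by (simp add: diff_def algebra_simps)
  also have "\<dots> = (\<Sum>k\<le>i. of_nat (i choose k) * (diff ^^ k) f n)
      + (\<Sum>k\<le>i. of_nat (i choose k) * (diff ^^ Suc k) f n)"
    by (subst (1 2) Suc) (simp add: funpow_Suc_right del: funpow.simps(2))
  also have "(\<Sum>k\<le>i. of_nat (i choose k) * (diff ^^ k) f n)
    = f n + (\<Sum>k\<le>i. of_nat (i choose Suc k) * (diff ^^ Suc k) f n)"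
    using sum.atMost_Suc_shift[of "\<lambda>k. of_nat (i choose k) * (diff ^^ k) f n" i]
    by (simp add: binomial_eq_0)
  finally show ?case
    by (subst sum.atMost_Suc_shift) (simp add: sum.distrib algebra_simps)
qed

text \<open>The witness \<open>q\<close> is the Newton form of the interpolating polynomial.\<close>

lemma newton_stencil:
  assumes "P \<ge> 1"
  shows "poly (stencil_poly P f n) (of_int n + x) = (\<Sum>k<P. (x gchoose k) * (diff ^^ k) f n)"
proof -
  define q :: "real poly" where "q = (\<Sum>k<P. smult ((diff ^^ k) f n / fact k)
      (\<Prod>j<k. [:- (of_int n + of_nat j), 1:]))"
  have val: "poly q (of_int n + x) = (\<Sum>k<P. (x gchoose k) * (diff ^^ k) f n)" for x
    by (simp add: q_def poly_sum poly_prod gbinomial_prod_rev algebra_simps atLeast0LessThan)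
  have "degree (\<Prod>j<k. [:- (of_int n + of_nat j), 1::real:]) \<le> (\<Sum>j<k. 1)" for k
    by (rule order.trans[OF degree_prod_sum_le]) (auto simp: o_def)
  then have "degree (smult c (\<Prod>j<k. [:- (of_int n + of_nat j), 1::real:])) \<le> P - 1"
    if "k < P" for c k
    using that order.trans[OF degree_smult_le, of _ k c] by force
  then have "degree q \<le> P - 1"
    unfolding q_def by (intro degree_sum_le) auto
  moreover have "poly q (of_int (n + int i)) = f (n + int i)" if "i < P" for i
  proof -
    have "poly q (of_int (n + int i)) = (\<Sum>k<P. of_nat (i choose k) * (diff ^^ k) f n)"
      using val[of "of_nat i"] by (simp add: binomial_gbinomial)
    also have "\<dots> = (\<Sum>k\<le>i. of_nat (i choose k) * (diff ^^ k) f n)"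
      using that by (intro sum.mono_neutral_right) (auto simp: binomial_eq_0)
    finally show ?thesis by (simp only: newton_forward)
  qed
  ultimately have "interpolates P f n q" by (simp add: interpolates_def)
  then have "stencil_poly P f n = q"
    unfolding stencil_poly_def using interpolates_ex1[OF assms] by (intro the1_equality)
  then show ?thesis using val by simp
qed

lemma right_scheme_eq_subdiv:
  assumes "P \<ge> 1"
  shows "right_scheme P = subdiv (lagrange P)"
proof (intro ext)
  fix f k
  show "right_scheme P f k = subdiv (lagrange P) f k"
    using assms newton_stencil[of P f "k div 2" "1/2"]
    by (auto simp: right_scheme_def subdiv_def dpoly_lagrange) (simp add: lagrange_def one_pCons)
qed

section \<open>The derived Lagrange schemes\<close>

text \<open>The congruence \<open>B = sqrt (1 + X) A\<close> modulo \<open>X ^ m\<close>, stated for formal power series. Since \<open>1 + X\<close>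
  stands for the shift by one coarse step, its square root is the shift by one fine step, and the
  congruence expresses the sum rules of order \<open>m\<close>.\<close>

definition sum_rules :: "nat \<Rightarrow> real poly \<times> real poly \<Rightarrow> bool" where
  "sum_rules m S \<longleftrightarrow>
    (\<forall>i<m. fps_nth (fps_of_poly (snd S) - fps_binomial (1 / 2) * fps_of_poly (fst S)) i = 0)"

lemma sum_rules_lagrange: "sum_rules P (lagrange P)"
  by (simp add: sum_rules_def lagrange_def nth_default_def)

lemma sum_rules_coeff_0: "sum_rules m S \<Longrightarrow> m \<ge> 1 \<Longrightarrow> coeff (snd S) 0 = coeff (fst S) 0"
  by (auto simp: sum_rules_def)

lemma fps_of_poly_shift_1:
  fixes p :: "real poly"
  shows "coeff p 0 = 0 \<Longrightarrow> fps_of_poly p = fps_X * fps_of_poly (poly_shift (Suc 0) p)"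
  by (cases p) (simp add: fps_of_poly_pCons mult.commute)

text \<open>With \<open>s = sqrt (1 + X)\<close> and derived pair \<open>(A', B')\<close>, one has
  \<open>X (B' - s A') = - (1 + s) (B - s A)\<close>, so that deriving costs one order.\<close>

lemma sum_rules_derived:
  assumes "sum_rules (Suc m) S"
  shows "sum_rules m (derived S)"
proof -
  let ?s = "fps_binomial (1 / 2 :: real)"
  let ?A = "fps_of_poly (fst S)" and ?B = "fps_of_poly (snd S)"
  let ?A' = "fps_of_poly (fst (derived S))" and ?B' = "fps_of_poly (snd (derived S))"
  have c: "coeff (snd S) 0 = coeff (fst S) 0" using sum_rules_coeff_0[OF assms] by simp
  have s2: "?s * ?s = 1 + fps_X"
    using fps_binomial_add_mult[of "1/2 :: real" "1/2"] by (simp add: fps_binomial_1)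
  have A': "fps_X * ?A' = ?B - ?A"
    using c fps_of_poly_shift_1[of "snd S - fst S"] by (simp add: derived_def fps_of_poly_diff)
  have B': "fps_X * ?B' = ?A + ?A * fps_X - ?B"
    using c fps_of_poly_shift_1[of "fst S + pCons 0 (fst S) - snd S"]
    by (simp add: derived_def fps_of_poly_diff fps_of_poly_add fps_of_poly_pCons)
  have "fps_X * (?B' - ?s * ?A') = (1 + fps_X) * ?A - ?B - ?s * (?B - ?A)"
    by (simp only: right_diff_distrib B' mult.left_commute[of _ ?s] A')
       (simp add: algebra_simps)
  also have "\<dots> = - (1 + ?s) * (?B - ?s * ?A)"
    unfolding s2[symmetric] by (simp add: algebra_simps)
  finally have e: "fps_X * (?B' - ?s * ?A') = - (1 + ?s) * (?B - ?s * ?A)" .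
  show ?thesis unfolding sum_rules_def
  proof (intro allI impI)
    fix i assume "i < m"
    have "fps_nth (?B' - ?s * ?A') i = fps_nth (fps_X * (?B' - ?s * ?A')) (Suc i)"
      by simp
    also have "\<dots> = 0"
      unfolding e fps_mult_nth using assms \<open>i < m\<close>
      by (intro sum.neutral) (auto simp: sum_rules_def)
    finally show "fps_nth (?B' - ?s * ?A') i = 0" .
  qed
qed

lemma derived_coeff_0:
  assumes "sum_rules m S" "m \<ge> 2"
  shows "coeff (fst (derived S)) 0 = coeff (fst S) 0 / 2"
proof -
  have "fps_nth (fps_of_poly (snd S) - fps_binomial (1 / 2) * fps_of_poly (fst S)) 1 = 0"
    using assms by (simp add: sum_rules_def)
  then have "coeff (snd S) 1 - coeff (fst S) 1 = coeff (fst S) 0 / 2"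
    by (simp add: fps_mult_nth)
  then show ?thesis by (simp add: derived_def coeff_poly_shift)
qed

text \<open>All derived schemes up to order \<open>P\<close> exist, and the \<open>k\<close>-th one multiplies a constant sequence by
  \<open>(1/2)\<^sup>k\<close> as long as \<open>k < P\<close>.\<close>

lemma derived_lagrange:
  assumes "k \<le> P"
  shows "sum_rules (P - k) ((derived ^^ k) (lagrange P))"
    and "k < P \<Longrightarrow> coeff (fst ((derived ^^ k) (lagrange P))) 0 = (1 / 2) ^ k"
    and "(diff ^^ k) (subdiv (lagrange P) f) = subdiv ((derived ^^ k) (lagrange P)) ((diff ^^ k) f)"
  using assms
proof (induction k)
  case 0
  { case 1 show ?case by (simp add: sum_rules_lagrange) }
  { case 2 show ?case by (simp add: lagrange_def) }
  { case 3 show ?case by simp }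
next
  case (Suc k)
  { case 1
    then have "sum_rules (Suc (P - Suc k)) ((derived ^^ k) (lagrange P))"
      using Suc(1) by (simp add: Suc_diff_Suc)
    then show ?case by (simp add: sum_rules_derived) }
  { case 2
    then show ?case using Suc(1) Suc(2) derived_coeff_0[of "P - k" "(derived ^^ k) (lagrange P)"]
      by simp }
  { case 3
    then have "coeff (fst ((derived ^^ k) (lagrange P))) 0 = coeff (snd ((derived ^^ k) (lagrange P))) 0"
      using Suc(1) sum_rules_coeff_0[of "P - k"] by simp
    then show ?case using Suc(3) 3 by (simp add: diff_subdiv) }
qed

section \<open>Geometric decay of differences\<close>

text \<open>Uniform geometric decay of a sequence of functions on the integers.\<close>

definition decays :: "(nat \<Rightarrow> int \<Rightarrow> real) \<Rightarrow> bool" where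
  "decays u \<longleftrightarrow> (\<exists>C r. 0 < r \<and> r < 1 \<and> (\<forall>j n. \<bar>u j n\<bar> \<le> C * r ^ j))"

text \<open>The rate may be enlarged to any number below \<open>1\<close>; a rate above \<open>1/2\<close> is what later estimates need.\<close>

lemma decaysE:
  assumes "decays u"
  obtains C r where "C \<ge> 0" "1/2 < r" "r < 1" "\<And>j n. \<bar>u j n\<bar> \<le> C * r ^ j"
proof -
  obtain C r where *: "0 < r" "r < 1" "\<And>j n. \<bar>u j n\<bar> \<le> C * r ^ j"
    using assms by (auto simp: decays_def)
  have C: "C \<ge> 0" using *(3)[of 0 0] by auto
  show ?thesis
  proof (rule that)
    show "\<bar>u j n\<bar> \<le> C * max r (3/4) ^ j" for j n
      using *(1) C by (intro order.trans[OF *(3)] mult_left_mono power_mono) auto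
  qed (use * C in auto)
qed

lemma decays_two_step:
  assumes "c < 1" and "\<And>n. \<bar>u 0 n\<bar> \<le> M" and "\<And>n. \<bar>u 1 n\<bar> \<le> M"
    and step: "\<And>j B. (\<And>n. \<bar>u j n\<bar> \<le> B) \<Longrightarrow> (\<And>n. \<bar>u (j + 2) n\<bar> \<le> c * B)"
  shows "decays u"
proof -
  \<comment> \<open>the bound \<open>1/4\<close> only keeps the rate positive\<close>
  define r where "r = sqrt (max c (1/4))"
  have r: "0 < r" "r < 1" "r\<^sup>2 = max c (1/4)"
    using assms(1) by (auto simp: r_def)
  have "M \<ge> 0" using assms(2)[of 0] by linarith
  \<comment> \<open>the constant is \<open>M / r\<close> since the bound \<open>M\<close> is assumed for \<open>j = 1\<close> as well\<close>
  have "(\<forall>n. \<bar>u j n\<bar> \<le> M / r * r ^ j) \<and> (\<forall>n. \<bar>u (Suc j) n\<bar> \<le> M / r * r ^ Suc j)" for j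
  proof (induction j)
    case 0
    have "M \<le> M / r" using r \<open>M \<ge> 0\<close> by (simp add: le_divide_eq mult_left_le)
    then show ?case using assms(2,3) r by (auto intro: order.trans)
  next
    case (Suc j)
    have "\<bar>u (Suc (Suc j)) n\<bar> \<le> M / r * r ^ Suc (Suc j)" for n
    proof -
      have "\<bar>u (Suc (Suc j)) n\<bar> \<le> c * (M / r * r ^ j)"
        using step[of j "M / r * r ^ j" n] Suc by simp
      also have "\<dots> \<le> r\<^sup>2 * (M / r * r ^ j)"
        using r \<open>M \<ge> 0\<close> by (intro mult_right_mono) auto
      also have "\<dots> = M / r * r ^ Suc (Suc j)" by (simp add: power2_eq_square)
      finally show ?thesis .
    qed
    with Suc show ?case by blast
  qed
  with r show ?thesis unfolding decays_def by blast
qed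

text \<open>A sequence that is halved in each step, up to an error controlled by a decaying sequence, decays.\<close>

lemma decays_perturbed:
  assumes "decays v" and "\<And>n. \<bar>u 0 n\<bar> \<le> M"
    and step: "\<And>j B D n. (\<And>n. \<bar>u j n\<bar> \<le> B) \<Longrightarrow> (\<And>n. \<bar>v j n\<bar> \<le> D) \<Longrightarrow> \<bar>u (Suc j) n\<bar> \<le> B / 2 + K * D"
    and "K \<ge> 0"
  shows "decays u"
proof -
  obtain C r where C: "C \<ge> 0" "1/2 < r" "r < 1" "\<And>j n. \<bar>v j n\<bar> \<le> C * r ^ j"
    using decaysE[OF assms(1)] by metis
  \<comment> \<open>chosen so that \<open>B / 2 + K * C \<le> B * r\<close>\<close>
  define B where "B = max M (K * C / (r - 1 / 2))"
  have "K * C / (r - 1 / 2) \<le> B" by (simp add: B_def)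
  then have B: "B / 2 + K * C \<le> B * r" using C by (simp add: field_simps)
  have "\<bar>u j n\<bar> \<le> B * r ^ j" for j n
  proof (induction j arbitrary: n)
    case 0
    show ?case using assms(2)[of n] by (simp add: B_def)
  next
    case (Suc j)
    have "\<bar>u (Suc j) n\<bar> \<le> (B * r ^ j) / 2 + K * (C * r ^ j)"
      by (intro step Suc C)
    also have "\<dots> = (B / 2 + K * C) * r ^ j" by (simp add: algebra_simps)
    also have "\<dots> \<le> (B * r) * r ^ j" using B C by (intro mult_right_mono) auto
    finally show ?case by (simp add: mult_ac)
  qed
  with C show ?thesis unfolding decays_def by (intro exI[of _ B] exI[of _ r]) auto
qed

lemma abs_diff_le:
  assumes "\<And>n. \<bar>f n\<bar> \<le> M"
  shows "\<bar>diff f n\<bar> \<le> 2 * M"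
  using assms[of n] assms[of "n + 1"] unfolding diff_def by linarith

lemma abs_diff_funpow_le: "(\<And>n. \<bar>f n\<bar> \<le> M) \<Longrightarrow> \<bar>(diff ^^ k) f n\<bar> \<le> 2 ^ k * M"
proof (induction k arbitrary: n)
  case (Suc k)
  then show ?case using abs_diff_le[of "(diff ^^ k) f" "2 ^ k * M" n] by simp
qed simp

lemma dpoly_bounded: "\<exists>K\<ge>0. \<forall>f M n. (\<forall>n. \<bar>f n\<bar> \<le> M) \<longrightarrow> \<bar>dpoly p f n\<bar> \<le> K * M"
proof (intro exI conjI allI impI)
  fix f :: "int \<Rightarrow> real" and M n assume f: "\<forall>n. \<bar>f n\<bar> \<le> M"
  have "\<bar>dpoly p f n\<bar> \<le> (\<Sum>i\<le>degree p. \<bar>coeff p i * (diff ^^ i) f n\<bar>)"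
    unfolding dpoly_def by (rule sum_abs)
  also have "\<dots> \<le> (\<Sum>i\<le>degree p. \<bar>coeff p i\<bar> * (2 ^ i * M))"
    unfolding abs_mult using f by (intro sum_mono mult_left_mono abs_diff_funpow_le) auto
  finally show "\<bar>dpoly p f n\<bar> \<le> (\<Sum>i\<le>degree p. \<bar>coeff p i\<bar> * 2 ^ i) * M"
    by (simp only: sum_distrib_right mult.assoc)
qed (intro sum_nonneg mult_nonneg_nonneg; simp)

text \<open>If both polynomials have the constant coefficient \<open>a\<close>, then the scheme is multiplication by \<open>a\<close> up to
  an error controlled by the first difference; the bound is stated for \<open>0 \<le> a \<le> 1/2\<close>.\<close>

lemma subdiv_near_half:
  assumes "coeff (fst S) 0 = a" "coeff (snd S) 0 = a" "0 \<le> a" "a \<le> 1 / 2"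
  shows "\<exists>K\<ge>0. \<forall>f B D n. (\<forall>n. \<bar>f n\<bar> \<le> B) \<longrightarrow> (\<forall>n. \<bar>diff f n\<bar> \<le> D) \<longrightarrow>
           \<bar>subdiv S f n\<bar> \<le> B / 2 + K * D"
proof -
  obtain p q where pq: "fst S = pCons a p" "snd S = pCons a q"
    using assms by (metis coeff_pCons_0 pCons_cases)
  obtain K where K: "K \<ge> 0" "\<And>f M n. (\<forall>n. \<bar>f n\<bar> \<le> M) \<Longrightarrow> \<bar>dpoly p f n\<bar> \<le> K * M"
    using dpoly_bounded[of p] by blast
  obtain L where L: "L \<ge> 0" "\<And>f M n. (\<forall>n. \<bar>f n\<bar> \<le> M) \<Longrightarrow> \<bar>dpoly q f n\<bar> \<le> L * M"
    using dpoly_bounded[of q] by blast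
  show ?thesis
  proof (intro exI[of _ "K + L"] conjI allI impI)
    fix f :: "int \<Rightarrow> real" and B D n
    assume f: "\<forall>n. \<bar>f n\<bar> \<le> B" and d: "\<forall>n. \<bar>diff f n\<bar> \<le> D"
    have a: "\<bar>a * f m\<bar> \<le> B / 2" for m
      using mult_mono[of a "1 / 2" "\<bar>f m\<bar>" B] assms f by (simp add: abs_mult)
    have "0 \<le> D" using d abs_ge_zero order.trans by blast
    then have "0 \<le> K * D" "0 \<le> L * D" using K L by auto
    then have "\<bar>dpoly p (diff f) m\<bar> \<le> (K + L) * D" "\<bar>dpoly q (diff f) m\<bar> \<le> (K + L) * D" for m
      unfolding distrib_right using K(2)[OF d, of m] L(2)[OF d, of m] by linarith+
    then have "\<bar>a * f m + dpoly p (diff f) m\<bar> \<le> B / 2 + (K + L) * D"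
      "\<bar>a * f m + dpoly q (diff f) m\<bar> \<le> B / 2 + (K + L) * D" for m
      by (auto intro!: order.trans[OF abs_triangle_ineq] add_mono a)
    then show "\<bar>subdiv S f n\<bar> \<le> B / 2 + (K + L) * D"
      by (simp add: subdiv_def pq)
  qed (use K L in auto)
qed

section \<open>Uniform convergence from decay of the first difference\<close>

text \<open>The step functions \<open>h j\<close> with the values of the \<open>j\<close>-th iterate on the dyadic intervals of level \<open>j\<close> form
  a uniform Cauchy sequence, because the scheme keeps old values. Their limit is continuous although the
  step functions are not: two points at distance below \<open>2\<^sup>-\<^sup>j\<close> lie in the same or in adjacent intervals,
  whose values differ by a first difference.\<close>

lemma uniformly_convergent_if_decays:
  assumes even: "\<And>f n. T f (2 * n) = f n"
    and decays: "\<And>f. f \<in> linf \<Longrightarrow> decays (\<lambda>j. diff ((T ^^ j) f))"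
  shows "uniformly_convergent_scheme T"
  unfolding uniformly_convergent_scheme_def
proof
  fix f assume "f \<in> linf"
  define u where "u j = (T ^^ j) f" for j
  obtain C r where C: "C \<ge> 0" "1/2 < r" "r < 1" and d: "\<And>j n. \<bar>diff (u j) n\<bar> \<le> C * r ^ j"
    using decaysE[OF decays[OF \<open>f \<in> linf\<close>]] unfolding u_def by metis
  define h where "h j x = u j \<lfloor>2 ^ j * x\<rfloor>" for j and x :: real
  have step: "\<bar>h (Suc j) x - h j x\<bar> \<le> C * r ^ j" for j x
  proof -
    let ?m = "\<lfloor>2 ^ j * x\<rfloor>"
    have "\<lfloor>2 ^ Suc j * x\<rfloor> = 2 * ?m \<or> \<lfloor>2 ^ Suc j * x\<rfloor> = 2 * ?m + 1"
      by (simp add: floor_eq_iff mult.assoc) linarith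
    moreover have "u (Suc j) (2 * ?m) = h j x"
      by (simp add: u_def h_def even)
    moreover have "\<bar>diff (u (Suc j)) (2 * ?m)\<bar> \<le> C * r ^ j"
      using C by (intro order.trans[OF d] mult_left_mono power_decreasing) auto
    ultimately show ?thesis using C
      by (auto simp: h_def diff_def)
  qed
  define E where "E = C / (1 - r)"
  have tail: "\<bar>h (j + m) x - h j x\<bar> \<le> E * r ^ j" for j m x
  proof -
    have "\<bar>h (j + m) x - h j x\<bar> \<le> C * r ^ j * (\<Sum>i<m. r ^ i)"
    proof (induction m)
      case (Suc m)
      then show ?case using step[of "j + m" x] by (simp add: algebra_simps power_add)
    qed simp
    also have "\<dots> \<le> C * r ^ j * (1 / (1 - r))"
      using C by (intro mult_left_mono) (simp_all add: sum_gp_strict divide_right_mono)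
    finally show ?thesis by (simp add: E_def)
  qed
  have E0: "(\<lambda>j. E * r ^ j) \<longlonglongrightarrow> 0"
    using C by (intro tendsto_mult_right_zero LIMSEQ_realpow_zero) auto
  have "Cauchy (\<lambda>j. h j x)" for x
  proof (rule CauchyI')
    fix e :: real assume "e > 0"
    then obtain J where J: "\<And>j. j \<ge> J \<Longrightarrow> \<bar>E * r ^ j\<bar> < e"
      using LIMSEQ_D[OF E0] by force
    have "dist (h m x) (h n x) < e" if "m \<ge> J" "n > m" for m n
      using tail[of m "n - m" x] J[OF that(1)] that(2)
      by (simp add: dist_real_def abs_minus_commute[of "h m x"])
    then show "\<exists>M. \<forall>m\<ge>M. \<forall>n>m. dist (h m x) (h n x) < e" by blast
  qed
  then obtain g where g: "\<And>x. (\<lambda>j. h j x) \<longlonglongrightarrow> g x"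
    unfolding Cauchy_convergent_iff convergent_def by metis
  have close: "\<bar>g x - h j x\<bar> \<le> E * r ^ j" for j x
  proof (rule LIMSEQ_le_const2)
    show "(\<lambda>m. \<bar>h (m + j) x - h j x\<bar>) \<longlonglongrightarrow> \<bar>g x - h j x\<bar>"
      using g by (intro tendsto_intros LIMSEQ_ignore_initial_segment)
    show "\<exists>N. \<forall>m\<ge>N. \<bar>h (m + j) x - h j x\<bar> \<le> E * r ^ j"
      using tail[of j _ x] by (auto simp: add.commute)
  qed
  have near: "\<bar>g x - g y\<bar> \<le> (2 * E + C) * r ^ j" if "\<bar>x - y\<bar> < 1 / 2 ^ j" for x y :: real and j
  proof -
    have "\<bar>2 ^ j * x - 2 ^ j * y\<bar> < 1"
      unfolding right_diff_distrib[symmetric] using that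
      by (simp add: abs_mult pos_less_divide_eq mult.commute)
    then have "\<lfloor>2 ^ j * x\<rfloor> = \<lfloor>2 ^ j * y\<rfloor> \<or> \<lfloor>2 ^ j * x\<rfloor> = \<lfloor>2 ^ j * y\<rfloor> + 1
        \<or> \<lfloor>2 ^ j * y\<rfloor> = \<lfloor>2 ^ j * x\<rfloor> + 1"
      by linarith
    moreover have "0 \<le> C * r ^ j" using C by simp
    ultimately have "\<bar>h j x - h j y\<bar> \<le> C * r ^ j"
      using d[of j "\<lfloor>2 ^ j * x\<rfloor>"] d[of j "\<lfloor>2 ^ j * y\<rfloor>"]
      by (auto simp: h_def diff_def abs_minus_commute)
    then show ?thesis using close[of x j] close[of y j] by (simp add: algebra_simps)
  qed
  have "continuous_on UNIV g"
    unfolding continuous_on_iff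
  proof (intro ballI allI impI)
    fix x e :: real assume "e > 0"
    have "(\<lambda>j. (2 * E + C) * r ^ j) \<longlonglongrightarrow> 0"
      using C by (intro tendsto_mult_right_zero LIMSEQ_realpow_zero) auto
    then have "\<forall>\<^sub>F j in sequentially. (2 * E + C) * r ^ j < e"
      using \<open>e > 0\<close> by (rule order_tendstoD)
    then obtain j where "(2 * E + C) * r ^ j < e"
      by (auto dest: eventually_happens)
    then show "\<exists>d>0. \<forall>y\<in>UNIV. dist y x < d \<longrightarrow> dist (g y) (g x) < e"
      using order.strict_trans1[OF near[of _ x j]]
      by (intro exI[of _ "1 / 2 ^ j"]) (simp add: dist_real_def)
  qed
  moreover have "(\<lambda>j. SUP n. ereal \<bar>(T ^^ j) f n - g (of_int n / 2 ^ j)\<bar>) \<longlonglongrightarrow> 0"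
  proof (rule tendsto_sandwich[OF _ _ tendsto_const])
    show "\<forall>\<^sub>F j in sequentially. 0 \<le> (SUP n. ereal \<bar>(T ^^ j) f n - g (of_int n / 2 ^ j)\<bar>)"
      by (auto intro!: always_eventually SUP_upper2[of 0])
    show "\<forall>\<^sub>F j in sequentially. (SUP n. ereal \<bar>(T ^^ j) f n - g (of_int n / 2 ^ j)\<bar>) \<le> ereal (E * r ^ j)"
    proof (intro always_eventually allI SUP_least)
      fix j and n :: int
      show "ereal \<bar>(T ^^ j) f n - g (of_int n / 2 ^ j)\<bar> \<le> ereal (E * r ^ j)"
        using close[of "of_int n / 2 ^ j" j] by (simp add: h_def u_def abs_minus_commute)
    qed
    show "(\<lambda>j. ereal (E * r ^ j)) \<longlonglongrightarrow> 0"
      using E0 by (simp add: zero_ereal_def)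
  qed
  ultimately show "\<exists>g :: real \<Rightarrow> real. continuous_on UNIV g \<and>
      (\<lambda>j. SUP n. ereal \<bar>(T ^^ j) f n - g (of_int n / 2 ^ j)\<bar>) \<longlonglongrightarrow> 0"
    by (intro exI[of _ g] conjI)
qed

section \<open>Reduction to a contractive derived scheme\<close>

text \<open>The square of the scheme contracts the supremum norm by the factor \<open>c\<close>. A single step would not do: for \<open>P = 7\<close> and
  \<open>P = 8\<close> the derived scheme of order \<open>P\<close> has norm above \<open>1\<close>.\<close>

definition contractive :: "real \<Rightarrow> real poly \<times> real poly \<Rightarrow> bool" where
  "contractive c S \<longleftrightarrow>
     (\<forall>f M n. (\<forall>n. \<bar>f n\<bar> \<le> M) \<longrightarrow> \<bar>subdiv S (subdiv S f) n\<bar> \<le> c * M)"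

lemma subdiv_bounded:
  "\<exists>K. \<forall>f M n. (\<forall>n. \<bar>f n\<bar> \<le> M) \<longrightarrow> \<bar>subdiv S f n\<bar> \<le> K * M"
proof -
  obtain K where K: "\<And>f M n. (\<forall>n. \<bar>f n\<bar> \<le> M) \<Longrightarrow> \<bar>dpoly (fst S) f n\<bar> \<le> K * M"
    using dpoly_bounded[of "fst S"] by blast
  obtain L where L: "\<And>f M n. (\<forall>n. \<bar>f n\<bar> \<le> M) \<Longrightarrow> \<bar>dpoly (snd S) f n\<bar> \<le> L * M"
    using dpoly_bounded[of "snd S"] by blast
  have "\<bar>subdiv S f n\<bar> \<le> max K L * M" if f: "\<forall>n. \<bar>f n\<bar> \<le> M" for f M n
  proof -
    have "0 \<le> M" using f abs_ge_zero order.trans by blast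
    then have "K * M \<le> max K L * M" "L * M \<le> max K L * M" by (auto intro!: mult_right_mono)
    then show ?thesis
      using K[OF f, of "n div 2"] L[OF f, of "n div 2"] by (auto simp: subdiv_def)
  qed
  then show ?thesis by blast
qed

text \<open>The decay of the \<open>P\<close>-th differences descends to differences of order \<open>k\<close> for \<open>k = P - 1, \<dots>, 1\<close>, since
  the derived scheme of order \<open>k\<close> is multiplication by \<open>(1/2)\<^sup>k\<close> up to differences of the next order.\<close>

lemma uniformly_convergent_if_contractive:
  assumes "P \<ge> 1" and "c < 1" and contr: "contractive c ((derived ^^ P) (lagrange P))"
  shows "uniformly_convergent_scheme (right_scheme P)"
proof (rule uniformly_convergent_if_decays)
  show "right_scheme P f (2 * n) = f n" for f n by (rule right_scheme_even)
  fix f assume "f \<in> linf"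
  then obtain M where M: "\<And>n. \<bar>f n\<bar> \<le> M"
    by (auto simp: linf_def bounded_iff)
  define u where "u j = (right_scheme P ^^ j) f" for j
  define S where "S k = (derived ^^ k) (lagrange P)" for k
  have u: "(diff ^^ k) (u (Suc j)) = subdiv (S k) ((diff ^^ k) (u j))" if "k \<le> P" for j k
    using derived_lagrange(3)[OF that] assms(1) by (simp add: u_def S_def right_scheme_eq_subdiv)
  have bd0: "\<bar>(diff ^^ k) (u 0) n\<bar> \<le> 2 ^ k * M" for k n
    using abs_diff_funpow_le[of f M] M by (simp add: u_def)
  have "decays (\<lambda>j. (diff ^^ Suc k) (u j))" if "k < P" for k
    using that
  proof (induction "P - Suc k" arbitrary: k)
    case 0
    then have k: "Suc k = P" by simp
    have c: "\<bar>subdiv (S P) (subdiv (S P) f) n\<bar> \<le> c * M" if "\<forall>n. \<bar>f n\<bar> \<le> M" for f M n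
      using contr that by (auto simp: contractive_def S_def)
    obtain K where K: "\<And>f M n. (\<forall>n. \<bar>f n\<bar> \<le> M) \<Longrightarrow> \<bar>subdiv (S P) f n\<bar> \<le> K * M"
      using subdiv_bounded[of "S P"] by blast
    show ?case unfolding k
    proof (rule decays_two_step)
      let ?B = "max (2 ^ P * M) (K * (2 ^ P * M))"
      show "\<bar>(diff ^^ P) (u 0) n\<bar> \<le> ?B" for n
        using bd0[of P n] by simp
      show "\<bar>(diff ^^ P) (u 1) n\<bar> \<le> ?B" for n
        using K[of "(diff ^^ P) (u 0)" "2 ^ P * M" n] bd0[of P] u[of P 0] by simp
      show "\<bar>(diff ^^ P) (u (j + 2)) n\<bar> \<le> c * B" if "\<And>n. \<bar>(diff ^^ P) (u j) n\<bar> \<le> B" for j B n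
        using c[of "(diff ^^ P) (u j)" B n] that u[of P j] u[of P "Suc j"] by simp
    qed (rule \<open>c < 1\<close>)
  next
    case (Suc d)
    have next_decays: "decays (\<lambda>j. (diff ^^ Suc (Suc k)) (u j))"
      using Suc by (intro Suc.hyps(1)) auto
    have k: "Suc k < P" using Suc by simp
    have S0: "coeff (fst (S (Suc k))) 0 = (1 / 2) ^ Suc k"
      "coeff (snd (S (Suc k))) 0 = (1 / 2) ^ Suc k"
      using derived_lagrange(1,2)[of "Suc k" P] sum_rules_coeff_0[of "P - Suc k" "S (Suc k)"] k
      by (auto simp: S_def)
    have le: "(1 / 2 :: real) ^ Suc k \<le> 1 / 2" "0 \<le> (1 / 2 :: real) ^ Suc k"
      by (simp_all add: power_le_one)
    obtain K where K: "K \<ge> 0" "\<forall>f B D n. (\<forall>n. \<bar>f n\<bar> \<le> B) \<longrightarrow> (\<forall>n. \<bar>diff f n\<bar> \<le> D) \<longrightarrow>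
           \<bar>subdiv (S (Suc k)) f n\<bar> \<le> B / 2 + K * D"
      using subdiv_near_half[OF S0 le(2,1)] by (elim exE conjE)
    show ?case
    proof (rule decays_perturbed[OF next_decays _ _ K(1)])
      show "\<bar>(diff ^^ Suc k) (u 0) n\<bar> \<le> 2 ^ Suc k * M" for n
        by (rule bd0)
      show "\<bar>(diff ^^ Suc k) (u (Suc j)) n\<bar> \<le> B / 2 + K * D"
        if "\<And>n. \<bar>(diff ^^ Suc k) (u j) n\<bar> \<le> B" "\<And>n. \<bar>(diff ^^ Suc (Suc k)) (u j) n\<bar> \<le> D"
        for j B D n
        using K(2)[rule_format, of "(diff ^^ Suc k) (u j)" B D n] that u[of "Suc k" j] k by simp
    qed
  qed
  from this[of 0] show "decays (\<lambda>j. diff ((right_scheme P ^^ j) f))"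
    using assms by (simp add: u_def)
qed

section \<open>Contractivity for two to eight points\<close>

lemma half_gchoose:
  "(1 / 2 :: real) gchoose 0 = 1" "(1 / 2 :: real) gchoose Suc 0 = 1 / 2"
  "(1 / 2 :: real) gchoose 2 = - 1 / 8" "(1 / 2 :: real) gchoose 3 = 1 / 16"
  "(1 / 2 :: real) gchoose 4 = - 5 / 128" "(1 / 2 :: real) gchoose 5 = 7 / 256"
  "(1 / 2 :: real) gchoose 6 = - 21 / 1024" "(1 / 2 :: real) gchoose 7 = 33 / 2048"
  by (simp_all add: gbinomial_prod_rev eval_nat_numeral)

lemma funpow_numeral: "f ^^ numeral k = f \<circ> f ^^ pred_numeral k"
  by (simp add: numeral_eq_Suc)

lemmas lagrange_eval = lagrange_def upt_rec[of 0] upt_rec[of "Suc 0"] numeral_2_eq_2[symmetric]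
  half_gchoose funpow_numeral derived_def one_pCons

lemma subdiv_even: "subdiv S f (2 * k) = dpoly (fst S) f k"
  and subdiv_odd: "subdiv S f (2 * k + 1) = dpoly (snd S) f k"
  by (simp_all add: subdiv_def)

text \<open>The constant \<open>9/10\<close> serves all \<open>P\<close> at once; the largest norm of a squared scheme is about \<open>0.825\<close>,
  for \<open>P = 8\<close>. Two steps of the scheme at \<open>4 k, \<dots>, 4 k + 3\<close> use at most the values at \<open>k, \<dots>, k + 4\<close>.\<close>

lemma contractiveI:
  assumes "\<And>f :: int \<Rightarrow> real. \<And>M k.
    \<lbrakk>\<bar>f k\<bar> \<le> M; \<bar>f (k + 1)\<bar> \<le> M; \<bar>f (k + 2)\<bar> \<le> M; \<bar>f (k + 3)\<bar> \<le> M; \<bar>f (k + 4)\<bar> \<le> M\<rbrakk> \<Longrightarrow>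
      \<bar>subdiv S (subdiv S f) (2 * (2 * k))\<bar> \<le> 9 / 10 * M \<and>
      \<bar>subdiv S (subdiv S f) (2 * (2 * k) + 1)\<bar> \<le> 9 / 10 * M \<and>
      \<bar>subdiv S (subdiv S f) (2 * (2 * k + 1))\<bar> \<le> 9 / 10 * M \<and>
      \<bar>subdiv S (subdiv S f) (2 * (2 * k + 1) + 1)\<bar> \<le> 9 / 10 * M"
  shows "contractive (9 / 10) S"
  unfolding contractive_def
proof (intro allI impI)
  fix f :: "int \<Rightarrow> real" and M and n :: int assume f: "\<forall>n. \<bar>f n\<bar> \<le> M"
  define k where "k = n div 4"
  have "n = 2 * (2 * k) \<or> n = 2 * (2 * k) + 1 \<or> n = 2 * (2 * k + 1) \<or> n = 2 * (2 * k + 1) + 1"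
    unfolding k_def by presburger
  moreover note assms[of f k M]
  ultimately show "\<bar>subdiv S (subdiv S f) n\<bar> \<le> 9 / 10 * M"
    using f by (elim disjE) simp_all
qed

lemma double_shift:
  fixes k :: int
  shows "2 * k + 2 = 2 * (k + 1)" "2 * k + 3 = 2 * (k + 1) + 1" "2 * k + 4 = 2 * (k + 2)"
    "2 * k + 1 + 1 = 2 * (k + 1)" "2 * k + 1 + 2 = 2 * (k + 1) + 1" "2 * k + 1 + 3 = 2 * (k + 2)"
    "k + 1 + 1 = k + 2" "k + 1 + 2 = k + 3" "k + 1 + 3 = k + 4"
    "k + 2 + 1 = k + 3" "k + 2 + 2 = k + 4"
  by simp_all

text \<open>In each of the following proofs, the derived pair is computed in powers of \<open>\<Delta>\<close>, expanded into shifts,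
  and the result of two steps is estimated by linear arithmetic.\<close>

lemma contractive_2:
  obtains c where "c < 1" "contractive c ((derived ^^ 2) (lagrange 2))"
proof (rule that)
  let ?S = "(derived ^^ 2) (lagrange 2)"
  show "contractive (9 / 10) ?S"
  proof (rule contractiveI)
    have S: "?S = (0,
        [:1 / 2:])"
      by (simp add: lagrange_eval)
    have even: "subdiv ?S f (2 * k) =
        0" for f k
      unfolding S subdiv_even by (simp add: diff_def field_simps)
    have odd: "subdiv ?S f (2 * k + 1) =
        1 / 2 * f k" for f k
      unfolding S subdiv_odd by (simp add: diff_def field_simps)
    fix f :: "int \<Rightarrow> real" and M k
    assume "\<bar>f k\<bar> \<le> M" "\<bar>f (k + 1)\<bar> \<le> M" "\<bar>f (k + 2)\<bar> \<le> M" "\<bar>f (k + 3)\<bar> \<le> M" "\<bar>f (k + 4)\<bar> \<le> M"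
    then show "\<bar>subdiv ?S (subdiv ?S f) (2 * (2 * k))\<bar> \<le> 9 / 10 * M \<and>
        \<bar>subdiv ?S (subdiv ?S f) (2 * (2 * k) + 1)\<bar> \<le> 9 / 10 * M \<and>
        \<bar>subdiv ?S (subdiv ?S f) (2 * (2 * k + 1))\<bar> \<le> 9 / 10 * M \<and>
        \<bar>subdiv ?S (subdiv ?S f) (2 * (2 * k + 1) + 1)\<bar> \<le> 9 / 10 * M"
      unfolding even odd double_shift abs_le_iff distrib_left[where ?'a = real]
        right_diff_distrib[where ?'a = real]
      by - (elim conjE, intro conjI; linarith)
  qed
qed simp

lemma contractive_3:
  obtains c where "c < 1" "contractive c ((derived ^^ 3) (lagrange 3))"
proof (rule that)
  let ?S = "(derived ^^ 3) (lagrange 3)"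
  show "contractive (9 / 10) ?S"
  proof (rule contractiveI)
    have S: "?S = ([:- 1 / 8:],
        [:3 / 8:])"
      by (simp add: lagrange_eval)
    have even: "subdiv ?S f (2 * k) =
        - 1 / 8 * f k" for f k
      unfolding S subdiv_even by (simp add: diff_def field_simps)
    have odd: "subdiv ?S f (2 * k + 1) =
        3 / 8 * f k" for f k
      unfolding S subdiv_odd by (simp add: diff_def field_simps)
    fix f :: "int \<Rightarrow> real" and M k
    assume "\<bar>f k\<bar> \<le> M" "\<bar>f (k + 1)\<bar> \<le> M" "\<bar>f (k + 2)\<bar> \<le> M" "\<bar>f (k + 3)\<bar> \<le> M" "\<bar>f (k + 4)\<bar> \<le> M"
    then show "\<bar>subdiv ?S (subdiv ?S f) (2 * (2 * k))\<bar> \<le> 9 / 10 * M \<and>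
        \<bar>subdiv ?S (subdiv ?S f) (2 * (2 * k) + 1)\<bar> \<le> 9 / 10 * M \<and>
        \<bar>subdiv ?S (subdiv ?S f) (2 * (2 * k + 1))\<bar> \<le> 9 / 10 * M \<and>
        \<bar>subdiv ?S (subdiv ?S f) (2 * (2 * k + 1) + 1)\<bar> \<le> 9 / 10 * M"
      unfolding even odd double_shift abs_le_iff distrib_left[where ?'a = real]
        right_diff_distrib[where ?'a = real]
      by - (elim conjE, intro conjI; linarith)
  qed
qed simp

lemma contractive_4:
  obtains c where "c < 1" "contractive c ((derived ^^ 4) (lagrange 4))"
proof (rule that)
  let ?S = "(derived ^^ 4) (lagrange 4)"
  show "contractive (9 / 10) ?S"
  proof (rule contractiveI)
    have S: "?S = ([:- 1 / 4:],
        [:3 / 8, 1 / 16:])"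
      by (simp add: lagrange_eval)
    have even: "subdiv ?S f (2 * k) =
        - 1 / 4 * f k" for f k
      unfolding S subdiv_even by (simp add: diff_def field_simps)
    have odd: "subdiv ?S f (2 * k + 1) =
        5 / 16 * f k + 1 / 16 * f (k + 1)" for f k
      unfolding S subdiv_odd by (simp add: diff_def field_simps)
    fix f :: "int \<Rightarrow> real" and M k
    assume "\<bar>f k\<bar> \<le> M" "\<bar>f (k + 1)\<bar> \<le> M" "\<bar>f (k + 2)\<bar> \<le> M" "\<bar>f (k + 3)\<bar> \<le> M" "\<bar>f (k + 4)\<bar> \<le> M"
    then show "\<bar>subdiv ?S (subdiv ?S f) (2 * (2 * k))\<bar> \<le> 9 / 10 * M \<and>
        \<bar>subdiv ?S (subdiv ?S f) (2 * (2 * k) + 1)\<bar> \<le> 9 / 10 * M \<and>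
        \<bar>subdiv ?S (subdiv ?S f) (2 * (2 * k + 1))\<bar> \<le> 9 / 10 * M \<and>
        \<bar>subdiv ?S (subdiv ?S f) (2 * (2 * k + 1) + 1)\<bar> \<le> 9 / 10 * M"
      unfolding even odd double_shift abs_le_iff distrib_left[where ?'a = real]
        right_diff_distrib[where ?'a = real]
      by - (elim conjE, intro conjI; linarith)
  qed
qed simp

lemma contractive_5:
  obtains c where "c < 1" "contractive c ((derived ^^ 5) (lagrange 5))"
proof (rule that)
  let ?S = "(derived ^^ 5) (lagrange 5)"
  show "contractive (9 / 10) ?S"
  proof (rule contractiveI)
    have S: "?S = ([:- 13 / 32, - 5 / 128:],
        [:15 / 32, 25 / 128:])"
      by (simp add: lagrange_eval)
    have even: "subdiv ?S f (2 * k) =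
        - 47 / 128 * f k - 5 / 128 * f (k + 1)" for f k
      unfolding S subdiv_even by (simp add: diff_def field_simps)
    have odd: "subdiv ?S f (2 * k + 1) =
        35 / 128 * f k + 25 / 128 * f (k + 1)" for f k
      unfolding S subdiv_odd by (simp add: diff_def field_simps)
    fix f :: "int \<Rightarrow> real" and M k
    assume "\<bar>f k\<bar> \<le> M" "\<bar>f (k + 1)\<bar> \<le> M" "\<bar>f (k + 2)\<bar> \<le> M" "\<bar>f (k + 3)\<bar> \<le> M" "\<bar>f (k + 4)\<bar> \<le> M"
    then show "\<bar>subdiv ?S (subdiv ?S f) (2 * (2 * k))\<bar> \<le> 9 / 10 * M \<and>
        \<bar>subdiv ?S (subdiv ?S f) (2 * (2 * k) + 1)\<bar> \<le> 9 / 10 * M \<and>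
        \<bar>subdiv ?S (subdiv ?S f) (2 * (2 * k + 1))\<bar> \<le> 9 / 10 * M \<and>
        \<bar>subdiv ?S (subdiv ?S f) (2 * (2 * k + 1) + 1)\<bar> \<le> 9 / 10 * M"
      unfolding even odd double_shift abs_le_iff distrib_left[where ?'a = real]
        right_diff_distrib[where ?'a = real]
      by - (elim conjE, intro conjI; linarith)
  qed
qed simp

lemma contractive_6:
  obtains c where "c < 1" "contractive c ((derived ^^ 6) (lagrange 6))"
proof (rule that)
  let ?S = "(derived ^^ 6) (lagrange 6)"
  show "contractive (9 / 10) ?S"
  proof (rule contractiveI)
    have S: "?S = ([:- 41 / 64, - 21 / 128:],
        [:43 / 64, 29 / 64, 7 / 256:])"
      by (simp add: lagrange_eval)
    have even: "subdiv ?S f (2 * k) =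
        - 61 / 128 * f k - 21 / 128 * f (k + 1)" for f k
      unfolding S subdiv_even by (simp add: diff_def field_simps)
    have odd: "subdiv ?S f (2 * k + 1) =
        63 / 256 * f k + 51 / 128 * f (k + 1) + 7 / 256 * f (k + 2)" for f k
      unfolding S subdiv_odd by (simp add: diff_def field_simps)
    fix f :: "int \<Rightarrow> real" and M k
    assume "\<bar>f k\<bar> \<le> M" "\<bar>f (k + 1)\<bar> \<le> M" "\<bar>f (k + 2)\<bar> \<le> M" "\<bar>f (k + 3)\<bar> \<le> M" "\<bar>f (k + 4)\<bar> \<le> M"
    then show "\<bar>subdiv ?S (subdiv ?S f) (2 * (2 * k))\<bar> \<le> 9 / 10 * M \<and>
        \<bar>subdiv ?S (subdiv ?S f) (2 * (2 * k) + 1)\<bar> \<le> 9 / 10 * M \<and>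
        \<bar>subdiv ?S (subdiv ?S f) (2 * (2 * k + 1))\<bar> \<le> 9 / 10 * M \<and>
        \<bar>subdiv ?S (subdiv ?S f) (2 * (2 * k + 1) + 1)\<bar> \<le> 9 / 10 * M"
      unfolding even odd double_shift abs_le_iff distrib_left[where ?'a = real]
        right_diff_distrib[where ?'a = real]
      by - (elim conjE, intro conjI; linarith)
  qed
qed simp

lemma contractive_7:
  obtains c where "c < 1" "contractive c ((derived ^^ 7) (lagrange 7))"
proof (rule that)
  let ?S = "(derived ^^ 7) (lagrange 7)"
  show "contractive (9 / 10) ?S"
  proof (rule contractiveI)
    have S: "?S = ([:- 131 / 128, - 119 / 256, - 21 / 1024:],
        [:133 / 128, 245 / 256, 147 / 1024:])"
      by (simp add: lagrange_eval)
    have even: "subdiv ?S f (2 * k) =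
        - 593 / 1024 * f k - 217 / 512 * f (k + 1) - 21 / 1024 * f (k + 2)" for f k
      unfolding S subdiv_even by (simp add: diff_def field_simps)
    have odd: "subdiv ?S f (2 * k + 1) =
        231 / 1024 * f k + 343 / 512 * f (k + 1) + 147 / 1024 * f (k + 2)" for f k
      unfolding S subdiv_odd by (simp add: diff_def field_simps)
    fix f :: "int \<Rightarrow> real" and M k
    assume "\<bar>f k\<bar> \<le> M" "\<bar>f (k + 1)\<bar> \<le> M" "\<bar>f (k + 2)\<bar> \<le> M" "\<bar>f (k + 3)\<bar> \<le> M" "\<bar>f (k + 4)\<bar> \<le> M"
    then show "\<bar>subdiv ?S (subdiv ?S f) (2 * (2 * k))\<bar> \<le> 9 / 10 * M \<and>
        \<bar>subdiv ?S (subdiv ?S f) (2 * (2 * k) + 1)\<bar> \<le> 9 / 10 * M \<and>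
        \<bar>subdiv ?S (subdiv ?S f) (2 * (2 * k + 1))\<bar> \<le> 9 / 10 * M \<and>
        \<bar>subdiv ?S (subdiv ?S f) (2 * (2 * k + 1) + 1)\<bar> \<le> 9 / 10 * M"
      unfolding even odd double_shift abs_le_iff distrib_left[where ?'a = real]
        right_diff_distrib[where ?'a = real]
      by - (elim conjE, intro conjI; linarith)
  qed
qed simp

lemma contractive_8:
  obtains c where "c < 1" "contractive c ((derived ^^ 8) (lagrange 8))"
proof (rule that)
  let ?S = "(derived ^^ 8) (lagrange 8)"
  show "contractive (9 / 10) ?S"
  proof (rule contractiveI)
    have S: "?S = ([:- 107 / 64, - 9 / 8, - 33 / 256:],
        [:215 / 128, 499 / 256, 507 / 1024, 33 / 2048:])"
      by (simp add: lagrange_eval)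
    have even: "subdiv ?S f (2 * k) =
        - 173 / 256 * f k - 111 / 128 * f (k + 1) - 33 / 256 * f (k + 2)" for f k
      unfolding S subdiv_even by (simp add: diff_def field_simps)
    have odd: "subdiv ?S f (2 * k + 1) =
        429 / 2048 * f k + 2063 / 2048 * f (k + 1) + 915 / 2048 * f (k + 2) + 33 / 2048 * f (k + 3)" for f k
      unfolding S subdiv_odd by (simp add: diff_def field_simps)
    fix f :: "int \<Rightarrow> real" and M k
    assume "\<bar>f k\<bar> \<le> M" "\<bar>f (k + 1)\<bar> \<le> M" "\<bar>f (k + 2)\<bar> \<le> M" "\<bar>f (k + 3)\<bar> \<le> M" "\<bar>f (k + 4)\<bar> \<le> M"
    then show "\<bar>subdiv ?S (subdiv ?S f) (2 * (2 * k))\<bar> \<le> 9 / 10 * M \<and>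
        \<bar>subdiv ?S (subdiv ?S f) (2 * (2 * k) + 1)\<bar> \<le> 9 / 10 * M \<and>
        \<bar>subdiv ?S (subdiv ?S f) (2 * (2 * k + 1))\<bar> \<le> 9 / 10 * M \<and>
        \<bar>subdiv ?S (subdiv ?S f) (2 * (2 * k + 1) + 1)\<bar> \<le> 9 / 10 * M"
      unfolding even odd double_shift abs_le_iff distrib_left[where ?'a = real]
        right_diff_distrib[where ?'a = real]
      by - (elim conjE, intro conjI; linarith)
  qed
qed simp

section \<open>Uniform convergence\<close>

theorem mainTheorem5:
  fixes P :: nat
  assumes "2 \<le> P" and "P \<le> 8"
  shows "uniformly_convergent_scheme (right_scheme P)"
proof -
  consider "P = 2" | "P = 3" | "P = 4" | "P = 5" | "P = 6" | "P = 7" | "P = 8"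
    using assms by linarith
  then have "\<exists>c<1. contractive c ((derived ^^ P) (lagrange P))"
  proof cases
    case 1
    show ?thesis unfolding 1 by (rule contractive_2) blast
  next
    case 2
    show ?thesis unfolding 2 by (rule contractive_3) blast
  next
    case 3
    show ?thesis unfolding 3 by (rule contractive_4) blast
  next
    case 4
    show ?thesis unfolding 4 by (rule contractive_5) blast
  next
    case 5
    show ?thesis unfolding 5 by (rule contractive_6) blast
  next
    case 6
    show ?thesis unfolding 6 by (rule contractive_7) blast
  next
    case 7
    show ?thesis unfolding 7 by (rule contractive_8) blast
  qed
  then obtain c where "c < 1" "contractive c ((derived ^^ P) (lagrange P))"
    by blast
  then show ?thesis
    using assms by (intro uniformly_convergent_if_contractive[of P c]) auto
qed

end
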